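(* There is a family $\mathcal F$ of finite subsets of $\omega_1$ such that every finite subset of $\omega_1$ is contained in some member of $\mathcal F$, and $\mathcal F$ has VC-dimension $2$.
   Context: For a set $X$ and $\mathcal F\subseteq\mathcal P(X)$, a subset $A\subseteq X$ is shattered by $\mathcal F$ if for every $S\subseteq A$ there is $F\in\mathcal F$ with $F\cap A=S$. The VC-dimension of $\mathcal F$ is the smallest $n$ such that no subset of $X$ of size $n+1$ is shattered by $\mathcal F$ (and $\infty$ if no such $n$ exists). *)

theory Defs
  imports Main "HOL-Library.Extended_Nat" "HOL-Library.Countable_Set"
begin

definition shattered :: "'a set set \<Rightarrow> 'a set \<Rightarrow> bool" where
  "shattered F A \<longleftrightarrow> (\<forall>S. S \<subseteq> A \<longrightarrow> (\<exists>B\<in>F. B \<inter> A = S))"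

definition vc_dim :: "'a set \<Rightarrow> 'a set set \<Rightarrow> enat" where
  "vc_dim X F =
    (if \<exists>n. \<not> (\<exists>A\<subseteq>X. finite A \<and> card A = n + 1 \<and> shattered F A)
     then enat (LEAST n. \<not> (\<exists>A\<subseteq>X. finite A \<and> card A = n + 1 \<and> shattered F A))
     else \<infinity>)"

text \<open>
  The ordinal \<open>\<omega>\<^sub>1\<close>, realised as the carrier of the library's cardinal successor of
  \<open>natLeq\<close>, i.e. of a well-order that is minimal among those of cardinality greater than
  \<open>\<aleph>\<^sub>0\<close>. That its points happen to be sets of naturals is an artefact of the type
  of \<open>cardSuc\<close>. The two lemmas below pin down the order type: the carrier is uncountable and
  all its proper initial segments are countable.
\<close>

definition omega1 :: "nat set set" where
  "omega1 = Field (cardSuc natLeq)"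

lemma uncountable_omega1:
  includes cardinal_syntax
  shows "uncountable omega1"
proof
  assume "countable omega1"
  then obtain f :: "nat set \<Rightarrow> nat" where "inj_on f omega1"
    by (auto simp: countable_def)
  then have "|omega1| \<le>o |UNIV :: nat set|"
    using card_of_ordLeq[of omega1 "UNIV :: nat set"] by blast
  moreover have "|omega1| =o cardSuc natLeq"
    unfolding omega1_def
    by (intro card_of_Field_ordIso cardSuc_Card_order natLeq_Card_order)
  moreover have "|UNIV :: nat set| =o natLeq"
    by (rule card_of_nat)
  ultimately have "cardSuc natLeq \<le>o natLeq"
    by (meson ordIso_ordLeq_trans ordIso_symmetric ordLeq_ordIso_trans)
  with cardSuc_greater[OF natLeq_Card_order] show False
    using not_ordLess_ordLeq by blast
qed

lemma countable_initial_segment_omega1: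
  includes cardinal_syntax
  assumes "a \<in> omega1"
  shows "countable (underS (cardSuc natLeq) a)"
proof -
  have "|underS (cardSuc natLeq) a| <o cardSuc natLeq"
    using assms unfolding omega1_def
    by (intro card_of_underS cardSuc_Card_order natLeq_Card_order)
  then have "|underS (cardSuc natLeq) a| \<le>o natLeq"
    using cardSuc_ordLeq_ordLess[OF natLeq_Card_order card_of_Card_order] by blast
  then have "|underS (cardSuc natLeq) a| \<le>o |UNIV :: nat set|"
    by (meson card_of_nat ordIso_symmetric ordLeq_ordIso_trans)
  then obtain f :: "nat set \<Rightarrow> nat" where "inj_on f (underS (cardSuc natLeq) a)"
    using card_of_ordLeq[of "underS (cardSuc natLeq) a" "UNIV :: nat set"] by blast
  then show ?thesis
    by (rule countableI)
qed

end

theory Submission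
  imports Defs
begin

text \<open>
  By recursion on \<open>y \<in> \<omega>\<^sub>1\<close> one builds finite sets \<open>H y 0 \<subseteq> H y 1 \<subseteq> \<dots>\<close> with union
  \<open>{x. x \<le> y}\<close> that are coherent: \<open>z \<in> H y n\<close> implies \<open>H y n \<inter> {x. x \<le> z} = H z n\<close>
  (in the language of ordinal metrics, \<open>H y n = {x \<le> y. \<rho> x y \<le> n}\<close>).
  At \<open>y\<close> one fixes a nondecreasing cofinal sequence \<open>g\<close> in \<open>{x. x < y}\<close> and lets \<open>H y n\<close>
  consist of \<open>y\<close> and of the sets \<open>H (g k) n\<close> for those \<open>k \<le> n\<close> for which
  \<open>g 0, \<dots>, g k\<close> is a chain of the \<open>n\<close>-th level, that is \<open>g i \<in> H (g (i + 1)) n\<close> for \<open>i < k\<close>.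
  The sets \<open>H y n\<close> are cofinal among the finite sets. If \<open>c\<close> is the largest element of a
  three-element set, then by coherence the traces below \<open>c\<close> of the members
  containing \<open>c\<close> are the sets \<open>H c n\<close>, which form a chain, so the set is not shattered.
\<close>

section \<open>Coherent finite approximations of countable initial segments\<close>

lemma countable_cofinal_sequence:
  assumes wo: "Well_order r" and cnt: "countable (underS r y)" and ne: "underS r y \<noteq> {}"
  obtains g :: "nat \<Rightarrow> 'a"
  where "\<And>k. g k \<in> underS r y" "\<And>k. (g k, g (Suc k)) \<in> r"
    "\<And>x. x \<in> underS r y \<Longrightarrow> \<exists>k. (x, g k) \<in> r"
proof -
  interpret R: wo_rel r using wo by (simp add: wo_rel_def)
  define d where "d = from_nat_into (underS r y)"
  have d: "d k \<in> underS r y" "d k \<in> Field r" for k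
    using from_nat_into[OF ne, of k] by (auto simp: d_def underS_def Field_def)
  \<comment> \<open>Running maxima of the enumeration \<open>d\<close>: each \<open>g k\<close> lies
    above \<open>d k\<close>, which gives cofinality. As \<open>g\<close> may repeat values,
    successors and limits need no case split; below a successor it is eventually constant.\<close>
  define g where "g = rec_nat (d 0) (\<lambda>k z. R.max2 z (d (Suc k)))"
  have g0: "g 0 = d 0" and gS: "g (Suc k) = R.max2 (g k) (d (Suc k))" for k
    by (simp_all add: g_def)
  have g: "g k \<in> underS r y \<and> g k \<in> Field r" for k
  proof (induction k)
    case (Suc k)
    then show ?case
      using d[of "Suc k"] R.max2_among[of "g k" "d (Suc k)"] by (auto simp: gS)
  qed (use d g0 in auto)
  have step: "(g k, g (Suc k)) \<in> r" and above: "(d (Suc k), g (Suc k)) \<in> r" for k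
    using R.max2_greater[of "g k" "d (Suc k)"] g[of k] d(2)[of "Suc k"] by (auto simp: gS)
  have "(d k, g k) \<in> r" for k
  proof (cases k)
    case 0
    then show ?thesis using g0 d(2)[of 0] R.REFL by (simp add: refl_on_def)
  qed (use above in auto)
  then have "\<exists>k. (x, g k) \<in> r" if "x \<in> underS r y" for x
    using from_nat_into_surj[OF cnt that] unfolding d_def by metis
  with that g step show ?thesis by blast
qed

text \<open>Let \<open>\<rho> x y\<close> be the least \<open>n\<close> with
  \<open>x \<in> H y n\<close>. The two inclusions of the last clause are then the ultrametric
  inequalities for \<open>x \<le> z \<le> y\<close>: one bounds \<open>\<rho> x y\<close> by the
  maximum of \<open>\<rho> x z\<close> and \<open>\<rho> z y\<close>, the other
  \<open>\<rho> x z\<close> by that of \<open>\<rho> x y\<close> and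
  \<open>\<rho> z y\<close>.\<close>

definition coherent_approximation :: "'a rel \<Rightarrow> ('a \<Rightarrow> nat \<Rightarrow> 'a set) \<Rightarrow> bool" where
  "coherent_approximation r H \<longleftrightarrow> (\<forall>y\<in>Field r.
     (\<forall>n. finite (H y n) \<and> y \<in> H y n \<and> H y n \<subseteq> under r y) \<and>
     (\<forall>m n. m \<le> n \<longrightarrow> H y m \<subseteq> H y n) \<and>
     (\<forall>x\<in>under r y. \<exists>n. x \<in> H y n) \<and>
     (\<forall>n. \<forall>z\<in>H y n. H y n \<inter> under r z = H z n))"

lemma coherent_approximation_exists:
  assumes wo: "Well_order r" and cnt: "\<And>y. y \<in> Field r \<Longrightarrow> countable (underS r y)"
  shows "\<exists>H. coherent_approximation r H"
proof -
  interpret R: wo_rel r using wo by (simp add: wo_rel_def)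
  define cofinal_seq where "cofinal_seq y g \<longleftrightarrow> (\<forall>k. g k \<in> underS r y) \<and>
      (\<forall>k. (g k, g (Suc k)) \<in> r) \<and> (\<forall>x\<in>underS r y. \<exists>k. (x, g k) \<in> r)" for y and g :: "nat \<Rightarrow> 'a"
  define G where "G y = (SOME g. cofinal_seq y g)" for y
  have "cofinal_seq y (G y)" if "underS r y \<noteq> {}" for y
  proof -
    from that have "y \<in> Field r" by (auto simp: underS_def Field_def)
    from countable_cofinal_sequence[OF wo cnt[OF this] that]
    have "\<exists>g. cofinal_seq y g" unfolding cofinal_seq_def by metis
    then show ?thesis unfolding G_def by (rule someI_ex)
  qed
  then have G: "G y k \<in> underS r y" "(G y k, G y (Suc k)) \<in> r"
      "x \<in> underS r y \<Longrightarrow> \<exists>k. (x, G y k) \<in> r" if "underS r y \<noteq> {}" for x y k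
    using that unfolding cofinal_seq_def by blast+
  \<comment> \<open>The bound \<open>k \<le> n\<close> keeps \<open>H y n\<close> finite. The chain
    condition makes the sets \<open>H (G y k) n\<close> nested in \<open>k\<close>. At the least
    element, where \<open>G y\<close> is an arbitrary value of the choice operator, \<open>K\<close>
    is empty.\<close>
  define K where "K f y n = {k. underS r y \<noteq> {} \<and> k \<le> n \<and> (\<forall>i<k. G y i \<in> f (G y (Suc i)) n)}"
    for f :: "'a \<Rightarrow> nat \<Rightarrow> 'a set" and y n
  define \<Phi> where "\<Phi> f y n = insert y (\<Union>k\<in>K f y n. f (G y k) n)" for f y n
  \<comment> \<open>\<open>\<Phi> f y\<close> evaluates \<open>f\<close> only at the points
    \<open>G y k\<close>, all strictly below \<open>y\<close>, so well-founded recursion provides a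
    fixed point.\<close>
  have adm: "R.adm_wo \<Phi>"
    unfolding R.adm_wo_def
  proof (intro allI impI)
    fix f g :: "'a \<Rightarrow> nat \<Rightarrow> 'a set" and y
    assume *: "\<forall>x\<in>underS r y. f x = g x"
    show "\<Phi> f y = \<Phi> g y"
    proof (cases "underS r y = {}")
      case False
      then have "f (G y k) = g (G y k)" for k using * G(1) by blast
      then show ?thesis by (simp add: \<Phi>_def K_def fun_eq_iff)
    qed (simp add: \<Phi>_def K_def fun_eq_iff)
  qed
  define H where "H = R.worec \<Phi>"
  have H: "H y n = insert y (\<Union>k\<in>K H y n. H (G y k) n)" for y n
    using fun_cong[OF fun_cong[OF R.worec_fixpoint[OF adm]], of y n]
    unfolding H_def[symmetric] by (simp only: \<Phi>_def)
  have K: "k \<in> K H y n \<Longrightarrow> underS r y \<noteq> {}" for k y n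
    by (simp add: K_def)
  have K_down: "k \<in> K H y n \<Longrightarrow> j \<le> k \<Longrightarrow> j \<in> K H y n" for j k y n
    by (auto simp: K_def)
  define good where "good y \<longleftrightarrow> (\<forall>n. finite (H y n)) \<and> (\<forall>n. H y n \<subseteq> under r y) \<and>
      (\<forall>n. H y n \<subseteq> H y (Suc n)) \<and> (\<forall>x\<in>under r y. \<exists>n. x \<in> H y n) \<and>
      (\<forall>n. \<forall>z\<in>H y n. H y n \<inter> under r z = H z n)" for y
  have lift: "H y m \<subseteq> H y n" if "good y" "m \<le> n" for y m n
    using lift_Suc_mono_le[of "H y" m n] that unfolding good_def by blast
  have trans: "(a, c) \<in> r" if "(a, b) \<in> r" "(b, c) \<in> r" for a b c
    using R.TRANS that by (meson transD)
  have good: "y \<in> Field r \<longrightarrow> good y" for y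
  proof (induction y rule: R.well_order_induct)
    case (1 y)
    show ?case
    proof
      assume y: "y \<in> Field r"
      have yy: "(y, y) \<in> r" using y R.REFL by (simp add: refl_on_def)
      have IH: "good x" if "x \<in> underS r y" for x
        using that 1 by (auto simp: underS_def Field_def)
      have IHG: "good (G y k)" if "underS r y \<noteq> {}" for k using IH G(1) that by blast
      have Gy: "(G y k, y) \<in> r" "G y k \<noteq> y" if "underS r y \<noteq> {}" for k
        using G(1)[OF that, of k] by (auto simp: underS_def)
      have sub: "H (G y k) n \<subseteq> underS r y" if "underS r y \<noteq> {}" for k n
      proof
        fix x assume "x \<in> H (G y k) n"
        then have "(x, G y k) \<in> r" using IHG[OF that, of k] by (auto simp: good_def under_def)
        then show "x \<in> underS r y"
          using Gy[OF that, of k] trans R.ANTISYM by (auto simp: underS_def dest: antisymD)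
      qed
      \<comment> \<open>Coherence at \<open>G y (Suc k)\<close>, applied to its element
        \<open>G y k\<close>, makes \<open>H (G y k) n\<close> an initial part of
        \<open>H (G y (Suc k)) n\<close>.\<close>
      have chain: "H (G y j) n \<subseteq> H (G y k) n" if "k \<in> K H y n" "j \<le> k" for j k n
        using that(2,1)
      proof (induction k rule: dec_induct)
        case (step k)
        have "G y k \<in> H (G y (Suc k)) n" using step.prems by (auto simp: K_def)
        then have "H (G y k) n \<subseteq> H (G y (Suc k)) n"
          using IHG[OF K[OF step.prems]] unfolding good_def by blast
        with step.IH K_down[OF step.prems, of k] show ?case by auto
      qed simp
      have fin: "finite (H y n)" for n
      proof -
        have "finite (K H y n)" by (rule finite_subset[of _ "{..n}"]) (auto simp: K_def)
        moreover have "finite (H (G y k) n)" if "k \<in> K H y n" for k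
          using IHG[OF K[OF that]] by (simp add: good_def)
        ultimately show ?thesis by (subst H) auto
      qed
      have un: "H y n \<subseteq> under r y" for n
        using sub K yy by (subst H) (fastforce simp: under_def underS_def)
      \<comment> \<open>An index admissible at level \<open>n\<close> stays admissible at
        \<open>Suc n\<close>, because the sets that witness its chain only grow.\<close>
      have mono: "H y n \<subseteq> H y (Suc n)" for n
      proof -
        have "k \<in> K H y (Suc n) \<and> H (G y k) n \<subseteq> H (G y k) (Suc n)" if "k \<in> K H y n" for k
          using that lift[OF IHG[OF K[OF that]], of n "Suc n"] unfolding K_def by fastforce
        then show ?thesis unfolding H[of y] by blast
      qed
      have cover: "\<exists>n. x \<in> H y n" if "x \<in> under r y" for x
      proof (cases "x = y")
        case True
        then show ?thesis using H[of y 0] by blast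
      next
        case False
        then have x: "x \<in> underS r y" using that by (auto simp: under_def underS_def)
        then have ne: "underS r y \<noteq> {}" by blast
        obtain k where "(x, G y k) \<in> r" using G(3)[OF ne x] by blast
        then obtain N where N: "x \<in> H (G y k) N"
          using IHG[OF ne, of k] by (auto simp: good_def under_def)
        have "\<exists>m. G y i \<in> H (G y (Suc i)) m" for i
          using IHG[OF ne, of "Suc i"] G(2)[OF ne, of i] by (auto simp: good_def under_def)
        then obtain M where M: "\<And>i. G y i \<in> H (G y (Suc i)) (M i)" by metis
        \<comment> \<open>One level above all requirements: \<open>N\<close> captures
          \<open>x\<close>, \<open>k\<close> allows the index \<open>k\<close>, and each
          \<open>M i\<close> secures the link from \<open>G y i\<close> to
          \<open>G y (Suc i)\<close>.\<close>
        define n where "n = N + k + (\<Sum>i<k. M i)"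
        have "M i \<le> n" if "i < k" for i
          using member_le_sum[of i "{..<k}" M] that by (simp add: n_def)
        then have "k \<in> K H y n"
          using M lift[OF IHG[OF ne]] ne by (fastforce simp: K_def n_def)
        moreover have "x \<in> H (G y k) n"
          using N lift[OF IHG[OF ne], of N n] by (auto simp: n_def)
        ultimately show ?thesis using H[of y n] by blast
      qed
      have coh: "H y n \<inter> under r z = H z n" if z: "z \<in> H y n" for z n
      proof (cases "z = y")
        case True
        then show ?thesis using un by blast
      next
        case False
        then obtain k where k: "k \<in> K H y n" "z \<in> H (G y k) n" using z H[of y n] by blast
        note ne = K[OF k(1)]
        have cohG: "H (G y j) n \<inter> under r z = H z n" if "z \<in> H (G y j) n" for j
          using IHG[OF ne, of j] that by (simp add: good_def)
        have zy: "z \<in> underS r y" using sub[OF ne] k(2) by blast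
        show ?thesis
        proof
          show "H z n \<subseteq> H y n \<inter> under r z"
            using cohG[OF k(2)] k(1) H[of y n] by blast
          show "H y n \<inter> under r z \<subseteq> H z n"
          proof
            fix w assume w: "w \<in> H y n \<inter> under r z"
            then have "w \<noteq> y"
              using zy R.ANTISYM by (auto simp: under_def underS_def dest: antisymD)
            then obtain j where j: "j \<in> K H y n" "w \<in> H (G y j) n" using w H[of y n] by blast
            \<comment> \<open>By nestedness the larger index puts \<open>w\<close> and
              \<open>z\<close> into a single set, to which the induction hypothesis applies.\<close>
            have "max j k \<in> K H y n" using j(1) k(1) by (simp add: max_def)
            then have "w \<in> H (G y (max j k)) n" "z \<in> H (G y (max j k)) n"
              using chain[of "max j k" n j] chain[of "max j k" n k] j(2) k(2) by auto
            then show "w \<in> H z n" using cohG w by blast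
          qed
        qed
      qed
      show "good y" unfolding good_def using fin un mono cover coh by blast
    qed
  qed
  have "y \<in> H y n" for y n using H[of y n] by blast
  then have "coherent_approximation r H"
    using good lift unfolding coherent_approximation_def good_def by simp
  then show ?thesis by blast
qed

section \<open>Auxiliary facts on VC-dimension and well-orders\<close>

lemma shattered_subset:
  assumes "shattered F A" and "C \<subseteq> A"
  shows "shattered F C"
  unfolding shattered_def
proof (intro allI impI)
  fix S assume S: "S \<subseteq> C"
  then obtain B where "B \<in> F" "B \<inter> A = S" using assms unfolding shattered_def by blast
  with S assms(2) show "\<exists>B\<in>F. B \<inter> C = S" by blast
qed

text \<open>Since shattering passes to subsets, a shattered set of size \<open>n\<close> yields one
  of every smaller size, which rules out any smaller candidate for the least value.\<close>

lemma vc_dim_eqI: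
  assumes "A \<subseteq> X" "finite A" "card A = n" "shattered F A"
    and no: "\<And>C. C \<subseteq> X \<Longrightarrow> finite C \<Longrightarrow> card C = Suc n \<Longrightarrow> \<not> shattered F C"
  shows "vc_dim X F = enat n"
proof -
  let ?P = "\<lambda>n. \<not> (\<exists>A\<subseteq>X. finite A \<and> card A = n + 1 \<and> shattered F A)"
  have P: "?P n" using no by auto
  have "(LEAST n. ?P n) = n"
  proof (rule Least_equality)
    show "?P n" by (fact P)
    fix m assume m: "?P m"
    show "n \<le> m"
    proof (rule ccontr)
      assume "\<not> n \<le> m"
      then have "m + 1 \<le> card A" using assms(3) by simp
      then obtain C where "C \<subseteq> A" "card C = m + 1" "finite C"
        by (rule obtain_subset_with_card_n)
      with m shattered_subset[OF assms(4)] assms(1) show False by blast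
    qed
  qed
  then show ?thesis using P unfolding vc_dim_def by (subst if_P) blast+
qed

text \<open>If all initial segments were finite, none could contain a countably infinite set
  \<open>C\<close>. Then \<open>C\<close> would be cofinal, and the field a countable union of
  finite sets.\<close>

lemma infinite_initial_segment:
  assumes wo: "Well_order r" and unc: "uncountable (Field r)"
  obtains b where "b \<in> Field r" "infinite (under r b)"
proof (rule ccontr)
  interpret R: wo_rel r using wo by (simp add: wo_rel_def)
  assume "\<not> thesis"
  with that have fin: "finite (under r b)" if "b \<in> Field r" for b using that by blast
  obtain C where C: "C \<subseteq> Field r" "infinite C" "countable C"
    using infinite_countable_subset'[OF uncountable_infinite[OF unc]] by blast
  have "Field r \<subseteq> (\<Union>c\<in>C. under r c)"
  proof
    fix b assume b: "b \<in> Field r"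
    have "\<not> C \<subseteq> under r b" using C(2) finite_subset[OF _ fin[OF b]] by blast
    then obtain c where "c \<in> C" "c \<notin> under r b" by blast
    then show "b \<in> (\<Union>c\<in>C. under r c)" using C(1) b R.TOTALS by (auto simp: under_def)
  qed
  moreover have "countable (\<Union>c\<in>C. under r c)"
    using C fin by (intro countable_UN) (auto intro: countable_finite)
  ultimately show False using unc by (simp add: countable_subset)
qed

lemma finite_has_greatest:
  assumes wo: "Well_order r" and "finite A" "A \<noteq> {}" "A \<subseteq> Field r"
  shows "\<exists>c\<in>A. A \<subseteq> under r c"
proof -
  interpret R: wo_rel r using wo by (simp add: wo_rel_def)
  show ?thesis using assms(2-4)
  proof (induction A rule: finite_ne_induct)
    case (singleton x)
    then show ?case using R.REFL by (auto simp: under_def refl_on_def)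
  next
    case (insert x A)
    then obtain c where c: "c \<in> A" "A \<subseteq> under r c" by auto
    have "(x, c) \<in> r \<or> (c, x) \<in> r" "(x, x) \<in> r"
      using insert.prems c(1) R.TOTALS R.REFL by (auto simp: refl_on_def)
    then show ?case
    proof (elim disjE)
      assume "(c, x) \<in> r"
      then have "under r c \<subseteq> under r x" using R.TRANS by (auto simp: under_def dest: transD)
      then show ?thesis using c \<open>(x, x) \<in> r\<close> by (auto simp: under_def)
    qed (use c in \<open>auto simp: under_def\<close>)
  qed
qed

section \<open>The cofinal family and its VC-dimension\<close>

lemma cofinal_family_vc_dim_2:
  assumes wo: "Well_order r" and cnt: "\<And>y. y \<in> Field r \<Longrightarrow> countable (underS r y)"
    and unc: "uncountable (Field r)"
  shows "\<exists>F. (\<forall>B\<in>F. finite B \<and> B \<subseteq> Field r) \<and>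
           (\<forall>A. finite A \<and> A \<subseteq> Field r \<longrightarrow> (\<exists>B\<in>F. A \<subseteq> B)) \<and> vc_dim (Field r) F = 2"
proof -
  interpret R: wo_rel r using wo by (simp add: wo_rel_def)
  obtain H where H: "coherent_approximation r H"
    using coherent_approximation_exists[OF wo cnt] by blast
  have fin: "finite (H y n)" and self: "y \<in> H y n" and un: "H y n \<subseteq> under r y"
    and mono: "m \<le> n \<Longrightarrow> H y m \<subseteq> H y n"
    and cover: "x \<in> under r y \<Longrightarrow> \<exists>n. x \<in> H y n"
    and coh: "z \<in> H y n \<Longrightarrow> H y n \<inter> under r z = H z n" if "y \<in> Field r" for x y z m n
    using H that by (simp_all add: coherent_approximation_def)
  \<comment> \<open>The empty set supplies the empty trace on the pair shattered below; it contains
    no greatest element \<open>c\<close>, so it does not affect the upper bound.\<close>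
  define F where "F = insert {} {H y n |y n. y \<in> Field r}"
  have HF: "H y n \<in> F" if "y \<in> Field r" for y n using that by (auto simp: F_def)
  have FH: "\<exists>y\<in>Field r. \<exists>n. B = H y n" if "B \<in> F" "c \<in> B" for B c
    using that by (auto simp: F_def)
  have mem: "\<forall>B\<in>F. finite B \<and> B \<subseteq> Field r"
    using fin un under_Field[of r] by (fastforce simp: F_def)
  have cof: "\<exists>B\<in>F. A \<subseteq> B" if A: "finite A" "A \<subseteq> Field r" for A
  proof (cases "A = {}")
    case True
    then show ?thesis by (auto simp: F_def)
  next
    case False
    then obtain c where c: "c \<in> A" "A \<subseteq> under r c" using finite_has_greatest[OF wo, of A] A by blast
    then have cF: "c \<in> Field r" using A by blast
    have "\<forall>x\<in>A. \<exists>n. x \<in> H c n" using cover[OF cF] c by blast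
    then obtain N where N: "\<And>x. x \<in> A \<Longrightarrow> x \<in> H c (N x)" by metis
    have "A \<subseteq> H c (\<Sum>x\<in>A. N x)"
    proof
      fix x assume x: "x \<in> A"
      then have "N x \<le> (\<Sum>x\<in>A. N x)" using member_le_sum[of x A N] A(1) by simp
      then show "x \<in> H c (\<Sum>x\<in>A. N x)" using N[OF x] mono[OF cF] by blast
    qed
    then show ?thesis using HF[OF cF] by blast
  qed
  \<comment> \<open>For the lower bound, \<open>b\<close> has infinitely many predecessors, so the
    finite set \<open>H b 0\<close> misses some \<open>a\<close> below \<open>b\<close>. This
    \<open>a\<close> enters at a later level, so both \<open>{b}\<close> and \<open>{a, b}\<close>
    are traces; \<open>H a 0\<close> gives \<open>{a}\<close>.\<close>
  obtain b where b: "b \<in> Field r" "infinite (under r b)"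
    using infinite_initial_segment[OF wo unc] by blast
  then have "\<not> under r b \<subseteq> H b 0" using finite_subset[OF _ fin[OF b(1)]] by blast
  then obtain a where a: "a \<in> under r b" "a \<notin> H b 0" by blast
  have ab: "a \<noteq> b" "(a, b) \<in> r" using a self[OF b(1), of 0] by (auto simp: under_def)
  have aF: "a \<in> Field r" using ab by (auto simp: Field_def)
  obtain n where n: "a \<in> H b n" using cover[OF b(1) a(1)] by blast
  have "b \<notin> H a 0"
    using un[OF aF, of 0] ab R.ANTISYM by (auto simp: under_def dest: antisymD)
  then have "H a 0 \<inter> {a, b} = {a}" "H b 0 \<inter> {a, b} = {b}" "H b n \<inter> {a, b} = {a, b}" "{} \<inter> {a, b} = {}"
    using self[OF aF] self[OF b(1)] a(2) n by auto
  moreover have "S = {} \<or> S = {a} \<or> S = {b} \<or> S = {a, b}" if "S \<subseteq> {a, b}" for S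
    using that by blast
  moreover have "{} \<in> F" by (simp add: F_def)
  ultimately have sh: "shattered F {a, b}"
    unfolding shattered_def using HF[OF aF] HF[OF b(1)] by metis
  have trace: "\<exists>n. B \<inter> under r c = H c n" if "B \<in> F" "c \<in> B" for B c
    using FH[OF that] coh that(2) by blast
  have "\<not> shattered F A" if A: "A \<subseteq> Field r" "finite A" "card A = Suc 2" for A
  proof
    assume sh: "shattered F A"
    have "A \<noteq> {}" using A(3) by auto
    then obtain c where c: "c \<in> A" "A \<subseteq> under r c" using finite_has_greatest[OF wo, of A] A by blast
    then have cF: "c \<in> Field r" using A by blast
    have "card (A - {c}) = 2" using A c(1) by simp
    then obtain x y where xy: "A - {c} = {x, y}" "x \<noteq> y" by (auto simp: card_2_iff)
    then have xyA: "x \<in> A" "y \<in> A" "x \<noteq> c" "y \<noteq> c" by blast+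
    \<comment> \<open>The traces \<open>{x, c}\<close> and \<open>{y, c}\<close> would force two
      incomparable sets \<open>H c m\<close> and \<open>H c n\<close>, against monotonicity in the
      level.\<close>
    obtain B where B: "B \<in> F" "B \<inter> A = {x, c}"
      using sh xyA c(1) unfolding shattered_def by (metis empty_subsetI insert_subset)
    obtain C where C: "C \<in> F" "C \<inter> A = {y, c}"
      using sh xyA c(1) unfolding shattered_def by (metis empty_subsetI insert_subset)
    obtain m n where "B \<inter> under r c = H c m" "C \<inter> under r c = H c n"
      using trace[of B c] trace[of C c] B C by blast
    moreover have "H c m \<subseteq> H c n \<or> H c n \<subseteq> H c m" using mono[OF cF] nat_le_linear by blast
    moreover have "x \<in> B \<inter> A" "x \<notin> C \<inter> A" "y \<in> C \<inter> A" "y \<notin> B \<inter> A"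
      unfolding B(2) C(2) using xyA xy(2) by simp_all
    moreover have "x \<in> under r c" "y \<in> under r c" using c(2) xyA by auto
    ultimately show False using xyA(1,2) by blast
  qed
  then have "vc_dim (Field r) F = enat 2"
    using vc_dim_eqI[of "{a, b}" "Field r" 2 F] aF b(1) ab(1) sh by simp
  then have "vc_dim (Field r) F = 2" by (simp add: numeral_eq_enat)
  with mem cof show ?thesis by (intro exI[of _ F]) simp
qed

theorem theorem3p8:
  shows "\<exists>F :: nat set set set.
           (\<forall>B\<in>F. finite B \<and> B \<subseteq> omega1) \<and>
           (\<forall>A. finite A \<and> A \<subseteq> omega1 \<longrightarrow> (\<exists>B\<in>F. A \<subseteq> B)) \<and>
           vc_dim omega1 F = 2"
proof -
  have "Well_order (cardSuc natLeq)"
    using cardSuc_Card_order[OF natLeq_Card_order] by (simp add: card_order_on_def)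
  from cofinal_family_vc_dim_2[OF this] show ?thesis
    using countable_initial_segment_omega1 uncountable_omega1 unfolding omega1_def by blast
qed

end
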